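(* Let $a,b,c$ be positive integers with $b\ge c$. Suppose that every $n\in\mathbb{N}=\{0,1,2,\ldots\}$ can be written as $n=ax^2+bt_y+ct_z$ with $x,y,z\in\mathbb{Z}$, where $t_y=y(y+1)/2$ and $t_z=z(z+1)/2$. Then $(a,b,c)$ is among the following vectors: $$(1,1,1),\ (1,2,1),\ (1,2,2),\ (1,3,1),\ (1,4,1),\ (1,4,2),\ (1,5,2),\ (1,6,1),\ (1,8,1),\ (2,1,1),\ (2,2,1),\ (2,4,1),\ (3,2,1),\ (4,1,1),\ (4,2,1).$$
   Context: $\mathbb{N}=\{0,1,2,\ldots\}$, and $t_x=x(x+1)/2$ for $x\in\mathbb{Z}$ denotes a triangular number. *)

theory Defs
  imports Main
begin

(* The product x * (x + 1) is always even, so the integer division is exact. *)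
definition triangular :: "int \<Rightarrow> int" where
  "triangular x = x * (x + 1) div 2"

end

theory Submission
  imports Defs
begin

text \<open>
  The proof is an escalation. If a partial form misses a number \<open>n\<close>, then a further
  coefficient exceeding \<open>n\<close> cannot help to represent it, because the values \<open>x\<^sup>2\<close> and
  \<open>t\<^sub>y\<close> are nonnegative and a nonzero one contributes at least its coefficient. Hence the
  first number missed by the coefficients found so far bounds the next coefficient. Starting
  from the empty form, which misses 1, this bounds everything:
  \<^item> Since 1 is represented and \<open>c \<le> b\<close>, either \<open>a = 1\<close> or \<open>c = 1\<close>.
  \<^item> If \<open>a = 1\<close>, then \<open>x\<^sup>2\<close> misses 2, so \<open>c \<le> 2\<close>; the forms \<open>x\<^sup>2 + t\<^sub>z\<close> and \<open>x\<^sup>2 + 2t\<^sub>z\<close>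
    miss 8 and 5, so \<open>b \<le> 8\<close> and \<open>b \<le> 5\<close> respectively.
  \<^item> If \<open>a \<ge> 2\<close> and \<open>c = 1\<close>, then \<open>t\<^sub>z\<close> misses 2, so \<open>a = 2\<close> or \<open>b \<le> 2\<close>. The form
    \<open>2x\<^sup>2 + t\<^sub>z\<close> misses 4, so \<open>b \<le> 4\<close> when \<open>a = 2\<close>. The forms \<open>2t\<^sub>y + t\<^sub>z\<close> and \<open>t\<^sub>y + t\<^sub>z\<close>
    miss 4 and 5, so \<open>a \<le> 4\<close> and \<open>a \<le> 5\<close> respectively.

  Of the finitely many vectors left, those to be excluded each miss a number at most 20:
  (1,5,1) misses 13, (1,7,1) misses 20, (1,3,2) misses 8, (2,3,1) misses 7, (3,1,1) misses 8
  and (5,1,1) misses 19. So only squares and triangular numbers up to 20 ever matter, and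
  every step becomes a finite check once these are listed
  (\<open>square_le_20\<close>, \<open>triangular_le_20\<close>).
\<close>

lemma triangular_nonneg: "triangular y \<ge> 0"
proof -
  have "y * (y + 1) \<ge> 0"
    by (cases "y \<ge> 0") (simp_all add: mult_nonpos_nonpos)
  then show ?thesis
    by (simp add: triangular_def)
qed

lemma triangular_le_20:
  assumes "triangular y \<le> 20"
  shows "triangular y \<in> {0, 1, 3, 6, 10, 15}"
proof -
  \<comment> \<open>The next triangular number is 21, attained at 6 and at -7.\<close>
  have small: "y * (y + 1) < 42"
    using assms by (simp add: triangular_def)
  have "y < 6"
    using small mult_mono[of 6 y 7 "y + 1"] by linarith
  moreover have "\<not> 7 \<le> - y"
    using small mult_mono[of 7 "- y" 6 "- y - 1"] by (auto simp: algebra_simps)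
  ultimately have "y \<in> set [-6..5]"
    unfolding set_upto atLeastAtMost_iff by linarith
  then show ?thesis
    by (simp add: upto_rec1 triangular_def) auto
qed

lemma square_le_20:
  fixes x :: int
  assumes "x\<^sup>2 \<le> 20"
  shows "x\<^sup>2 \<in> {0, 1, 4, 9, 16}"
proof -
  have "\<not> 5 \<le> \<bar>x\<bar>"
    using assms power_mono[of 5 "\<bar>x\<bar>" 2] by auto
  then have "x \<in> set [-4..4]"
    unfolding set_upto atLeastAtMost_iff by linarith
  then show ?thesis
    by (simp add: upto_rec1) auto
qed

text \<open>
  With positive coefficients none of the three values can exceed the number represented. The
  bounds by \<open>n\<close> prune the finite search, so that for small \<open>n\<close> only a few combinations
  have to be compared with unknown coefficients.
\<close>

lemma representation_le_20:
  fixes a b c n :: int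
  assumes pos: "a > 0" "b > 0" "c > 0"
    and n: "n \<le> 20"
    and rep: "n = a * x\<^sup>2 + b * triangular y + c * triangular z"
  shows "\<exists>X\<in>{0, 1, 4, 9, 16}. \<exists>Y\<in>{0, 1, 3, 6, 10, 15}. \<exists>Z\<in>{0, 1, 3, 6, 10, 15}.
    X \<le> n \<and> Y \<le> n \<and> Z \<le> n \<and> n = a * X + b * Y + c * Z"
proof -
  have le_mult: "v \<le> k * v" if "k > 0" "v \<ge> 0" for k v :: int
    using that mult_right_mono[of 1 k v] by simp
  have "x\<^sup>2 \<le> a * x\<^sup>2" "triangular y \<le> b * triangular y" "triangular z \<le> c * triangular z"
    using pos by (simp_all add: le_mult triangular_nonneg)
  moreover have "x\<^sup>2 \<ge> 0" "triangular y \<ge> 0" "triangular z \<ge> 0"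
    by (simp_all add: triangular_nonneg)
  ultimately have "x\<^sup>2 \<le> n" "triangular y \<le> n" "triangular z \<le> n"
    using rep by linarith+
  moreover from this have "x\<^sup>2 \<in> {0, 1, 4, 9, 16}"
    "triangular y \<in> {0, 1, 3, 6, 10, 15}" "triangular z \<in> {0, 1, 3, 6, 10, 15}"
    using n by (simp_all only: square_le_20 triangular_le_20 order.trans[OF _ n])
  ultimately show ?thesis
    using rep by (intro bexI[of _ "x\<^sup>2"] bexI[of _ "triangular y"] bexI[of _ "triangular z"] conjI)
qed

theorem theorem3:
  fixes a b c :: int
  assumes "a > 0" and "b > 0" and "c > 0"
    and "b \<ge> c"
    and "\<forall>n::nat. \<exists>x y z::int. int n = a * x^2 + b * triangular y + c * triangular z"
  shows "(a, b, c) \<in>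
    {(1,1,1), (1,2,1), (1,2,2), (1,3,1), (1,4,1), (1,4,2), (1,5,2), (1,6,1), (1,8,1),
     (2,1,1), (2,2,1), (2,4,1), (3,2,1), (4,1,1), (4,2,1)}"
proof -
  have rep: "\<exists>X\<in>{0, 1, 4, 9, 16}. \<exists>Y\<in>{0, 1, 3, 6, 10, 15}. \<exists>Z\<in>{0, 1, 3, 6, 10, 15}.
      X \<le> n \<and> Y \<le> n \<and> Z \<le> n \<and> n = a * X + b * Y + c * Z"
    if "0 \<le> n" "n \<le> 20" for n :: int
  proof -
    obtain x y z where "int (nat n) = a * x\<^sup>2 + b * triangular y + c * triangular z"
      using assms(5) by blast
    then show ?thesis
      using that assms(1-3) representation_le_20[of a b c n x y z] by simp
  qed
  have "a = 1 \<or> c = 1"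
    using rep[of 1] assms(1-4) by auto
  then consider (a1) "a = 1" | (c1) "a \<ge> 2" "c = 1"
    using assms(1) by linarith
  then show ?thesis
  proof cases
    case a1
    have "c \<le> 2"
      using rep[of 2] assms(1-4) a1 by auto
    then consider (c1) "c = 1" | (c2) "c = 2"
      using assms(3) by linarith
    then show ?thesis
    proof cases
      case c1
      have "b \<le> 8"
        using rep[of 8] assms(2) a1 c1 by auto
      moreover have "b \<noteq> 5"
        using rep[of 13] a1 c1 by auto
      moreover have "b \<noteq> 7"
        using rep[of 20] a1 c1 by auto
      ultimately show ?thesis
        using assms(2) a1 c1 by simp presburger
    next
      case c2
      have "b \<le> 5"
        using rep[of 5] assms(2) a1 c2 by auto
      moreover have "b \<noteq> 3"
        using rep[of 8] a1 c2 by auto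
      ultimately show ?thesis
        using assms(4) a1 c2 by simp presburger
    qed
  next
    case c1
    have "a = 2 \<or> b \<le> 2"
      using rep[of 2] assms(2) c1 by auto
    then consider (a2) "a = 2" | (b2) "a \<ge> 3" "b = 2" | (b1) "a \<ge> 3" "b = 1"
      using assms(2) c1 by linarith
    then show ?thesis
    proof cases
      case a2
      have "b \<le> 4"
        using rep[of 4] assms(2) c1 a2 by auto
      moreover have "b \<noteq> 3"
        using rep[of 7] c1 a2 by auto
      ultimately show ?thesis
        using assms(2) c1 a2 by simp presburger
    next
      case b2
      have "a \<le> 4"
        using rep[of 4] c1 b2 by auto
      then show ?thesis
        using c1 b2 by simp presburger
    next
      case b1
      have "a \<le> 5"
        using rep[of 5] c1 b1 by auto
      moreover have "a \<noteq> 3"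
        using rep[of 8] c1 b1 by auto
      moreover have "a \<noteq> 5"
        using rep[of 19] c1 b1 by auto
      ultimately show ?thesis
        using c1 b1 by simp
    qed
  qed
qed

end
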